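(* Let $k$ be a field and $V$ a $k$-vector space. Define $\mathcal{T} \subseteq \mathrm{End}_k(V)$ to be the subset of all triangularizable transformations, and let $\overline{\mathcal{T}} \subseteq \mathrm{End}_k(V)$ be the closure of $\mathcal{T}$ in the function topology. Then for all $T \in \mathrm{End}_k(V)$, we have $T \in \overline{\mathcal{T}}$ if and only if the restriction of $T$ to any finite-dimensional $T$-invariant subspace of $V$ is triangularizable. In particular, if $k$ is algebraically closed, then $\overline{\mathcal{T}} = \mathrm{End}_k(V)$.
   Context: $V$ has arbitrary dimension. $\mathrm{End}_k(V)$ is the $k$-algebra of all linear transformations of $V$, and $\langle X\rangle$ is the subspace generated by $X$. Given a vector space $U$, a basis $\mathcal{B}$ for $U$ and a partial order $\leq$ on $\mathcal{B}$, $T \in \mathrm{End}_k(U)$ is triangular with respect to $(\mathcal{B}, \leq)$ if $T(v) \in \langle \{u \in \mathcal{B} \mid u \leq v\} \rangle$ for all $v \in \mathcal{B}$; $T$ is triangularizable if it is triangular with respect to some well-ordered basis for $U$. A subspace $W\subseteq V$ is $T$-invariant if $T(W) \subseteq W$, and then $T|_W$ is regarded as an element of $\mathrm{End}_k(W)$. The function topology on $\mathrm{End}_k(V)$ is the topology having as a base of open sets the sets $\{S \in \mathrm{End}_k(V) \mid S|_W=T|_W\}$, for $T \in \mathrm{End}_k(V)$ and $W \subseteq V$ a finite-dimensional subspace (equivalently, the subspace topology inherited from the product topology on $V^V$, with $V$ discrete). *)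

theory Defs
  imports "HOL-Analysis.Function_Topology" "HOL-Computational_Algebra.Polynomial"
begin

text \<open>The library has only a type class of algebraically closed fields. A predicate is needed to
  use algebraic closedness as a hypothesis on an arbitrary field.\<close>

definition algebraically_closed_type :: "'k::field itself \<Rightarrow> bool"
  where "algebraically_closed_type _ \<longleftrightarrow> (\<forall>p::'k poly. degree p > 0 \<longrightarrow> (\<exists>x. poly p x = 0))"

lemma algebraically_closed_type_class: "algebraically_closed_type TYPE('k::alg_closed_field)"
  by (simp add: algebraically_closed_type_def alg_closed_imp_poly_has_root)

lemma algebraically_closed_type_imp_class:
  assumes "algebraically_closed_type TYPE('k::field)"
  shows "OFCLASS('k, alg_closed_field_class)"
proof (rule alg_closedI)
  fix p :: "'k poly"
  assume "degree p > 0"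
  then show "\<exists>x. poly p x = 0"
    using assms by (simp add: algebraically_closed_type_def)
qed

text \<open>A \<open>'k\<close>-vector space is given by its scalar multiplication \<open>sc\<close>, subject to
  \<^term>\<open>vector_space sc\<close>, and the ambient space is the whole type \<open>'v\<close>. Independence and
  span in a subspace agree with independence and span in the ambient space.\<close>

type_synonym ('k, 'v) scaling = "'k \<Rightarrow> 'v \<Rightarrow> 'v"

definition basis_of :: "('k::field, 'v::ab_group_add) scaling \<Rightarrow> 'v set \<Rightarrow> 'v set \<Rightarrow> bool"
  where "basis_of sc B U \<longleftrightarrow> \<not> module.dependent sc B \<and> module.span sc B = U"

definition finite_dim_subspace :: "('k::field, 'v::ab_group_add) scaling \<Rightarrow> 'v set \<Rightarrow> bool"
  where "finite_dim_subspace sc W \<longleftrightarrow> (\<exists>B. finite B \<and> basis_of sc B W)"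

definition End_space :: "('k::field, 'v::ab_group_add) scaling \<Rightarrow> ('v \<Rightarrow> 'v) set"
  where "End_space sc = {T. Vector_Spaces.linear sc sc T}"

definition invariant_subspace ::
    "('k::field, 'v::ab_group_add) scaling \<Rightarrow> ('v \<Rightarrow> 'v) \<Rightarrow> 'v set \<Rightarrow> bool"
  where "invariant_subspace sc T W \<longleftrightarrow> module.subspace sc W \<and> T ` W \<subseteq> W"

definition triangular ::
    "('k::field, 'v::ab_group_add) scaling \<Rightarrow> 'v set \<Rightarrow> ('v \<times> 'v) set \<Rightarrow> ('v \<Rightarrow> 'v) \<Rightarrow> bool"
  where "triangular sc B r T \<longleftrightarrow> (\<forall>v\<in>B. T v \<in> module.span sc {u \<in> B. (u, v) \<in> r})"

text \<open>For a subspace \<open>U\<close> invariant under \<open>T\<close>, the next definition says that the restriction of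
  \<open>T\<close> to \<open>U\<close>, as an endomorphism of \<open>U\<close>, is triangularizable: only the values of \<open>T\<close> on \<open>U\<close>
  matter. Note that \<^const>\<open>well_order_on\<close> relations are reflexive.\<close>

definition triangularizable_on ::
    "('k::field, 'v::ab_group_add) scaling \<Rightarrow> 'v set \<Rightarrow> ('v \<Rightarrow> 'v) \<Rightarrow> bool"
  where "triangularizable_on sc U T \<longleftrightarrow>
    (\<exists>B r. basis_of sc B U \<and> well_order_on B r \<and> triangular sc B r T)"

definition triangularizables :: "('k::field, 'v::ab_group_add) scaling \<Rightarrow> ('v \<Rightarrow> 'v) set"
  where "triangularizables sc = {T \<in> End_space sc. triangularizable_on sc UNIV T}"

definition function_topology_base :: "('k::field, 'v::ab_group_add) scaling \<Rightarrow> ('v \<Rightarrow> 'v) set set"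
  where "function_topology_base sc =
    {{S \<in> End_space sc. \<forall>w\<in>W. S w = T w} | T W. T \<in> End_space sc \<and> finite_dim_subspace sc W}"

definition function_topology :: "('k::field, 'v::ab_group_add) scaling \<Rightarrow> ('v \<Rightarrow> 'v) topology"
  where "function_topology sc =
    topology (arbitrary union_of (\<lambda>N. N \<in> function_topology_base sc))"

context vector_space
begin

lemma finite_dim_subspace_span:
  assumes "finite F"
  shows "finite_dim_subspace scale (span F)"
proof -
  obtain B where "B \<subseteq> F" "independent B" "span B = span F"
  proof (rule maximal_independent_subset[of F])
    fix B
    assume B: "B \<subseteq> F" "independent B" "F \<subseteq> span B"
    then have "span B = span F"
      using span_superset[of F] by (simp add: span_eq subset_trans)
    with B show ?thesis
      by (intro that)
  qed
  then show ?thesis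
    using finite_subset[OF _ assms] unfolding finite_dim_subspace_def basis_of_def by blast
qed

text \<open>The function topology is the subspace topology inherited from the product topology on all
  functions, with the vector space discrete.\<close>

lemma function_topology_eq_product:
  "function_topology scale =
     subtopology (product_topology (\<lambda>_. discrete_topology UNIV) UNIV) (End_space scale)"
  (is "_ = subtopology ?P _")
  unfolding function_topology_def
proof (rule topology_base_unique)
  fix N
  assume "N \<in> function_topology_base scale"
  then obtain T B where T: "T \<in> End_space scale" and B: "finite B"
    and N: "N = {S \<in> End_space scale. \<forall>w\<in>span B. S w = T w}"
    unfolding function_topology_base_def finite_dim_subspace_def basis_of_def by auto
  have eq: "(\<forall>w\<in>span B. S w = T w) \<longleftrightarrow> (\<forall>b\<in>B. S b = T b)" if "S \<in> End_space scale" for S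
  proof -
    interpret vector_space_pair scale scale ..
    have "S w = T w" if "\<forall>b\<in>B. S b = T b" "w \<in> span B" for w
      using linear_eq_on_span[of S T B w] \<open>S \<in> _\<close> T that by (simp add: End_space_def)
    then show ?thesis
      using span_base by blast
  qed
  have Pi: "S \<in> PiE UNIV (\<lambda>x. if x \<in> B then {T x} else UNIV) \<longleftrightarrow> (\<forall>b\<in>B. S b = T b)" for S
  proof -
    have "(S x \<in> (if x \<in> B then {T x} else UNIV)) \<longleftrightarrow> (x \<in> B \<longrightarrow> S x = T x)" for x
      by simp
    then show ?thesis
      by (simp only: PiE_UNIV_domain Pi_iff) blast
  qed
  have "N = PiE UNIV (\<lambda>x. if x \<in> B then {T x} else UNIV) \<inter> End_space scale"
  proof (rule set_eqI)
    fix S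
    show "S \<in> N \<longleftrightarrow> S \<in> PiE UNIV (\<lambda>x. if x \<in> B then {T x} else UNIV) \<inter> End_space scale"
      unfolding N mem_Collect_eq Int_iff Pi using eq[of S] by argo
  qed
  moreover have "openin ?P (PiE UNIV (\<lambda>x. if x \<in> B then {T x} else UNIV))"
  proof (rule product_topology_basis)
    show "finite {i. (if i \<in> B then {T i} else UNIV) \<noteq> topspace (discrete_topology UNIV)}"
      by (rule finite_subset[OF _ B]) (simp add: subset_iff)
  qed simp
  ultimately show "openin (subtopology ?P (End_space scale)) N"
    unfolding openin_subtopology by (intro exI conjI)
next
  fix U T
  assume "openin (subtopology ?P (End_space scale)) U" and TU: "T \<in> U"
  then obtain O' where O': "openin ?P O'" and U: "U = O' \<inter> End_space scale"
    unfolding openin_subtopology by (elim exE conjE)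
  have "T \<in> O'"
    using TU U by simp
  then obtain X where X: "finite {i. X i \<noteq> UNIV}" "T \<in> PiE UNIV X" "PiE UNIV X \<subseteq> O'"
    using O' unfolding openin_product_topology_alt by auto
  define N where "N = {S \<in> End_space scale. \<forall>w\<in>span {i. X i \<noteq> UNIV}. S w = T w}"
  have "N \<in> function_topology_base scale"
    unfolding N_def function_topology_base_def
    using TU U finite_dim_subspace_span[OF X(1)] by auto
  moreover have "T \<in> N"
    using TU U by (simp add: N_def)
  moreover have "N \<subseteq> U"
  proof
    fix S
    assume S: "S \<in> N"
    have "S i \<in> X i" for i
    proof (cases "X i = UNIV")
      case False
      then have "i \<in> span {i. X i \<noteq> UNIV}"
        by (intro span_base CollectI)
      with S have "S i = T i"
        unfolding N_def by blast
      then show ?thesis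
        using X(2) by (simp add: PiE_UNIV_domain Pi_iff)
    next
      case True
      then show ?thesis
        by simp
    qed
    then have "S \<in> O'"
      by (intro subsetD[OF X(3)]) (simp add: PiE_UNIV_domain Pi_iff)
    with S show "S \<in> U"
      by (simp add: N_def U)
  qed
  ultimately show "\<exists>B. B \<in> function_topology_base scale \<and> T \<in> B \<and> B \<subseteq> U"
    by blast
qed

end

end

theory Submission
  imports Defs
begin

text \<open>A triangularizable transformation is triangularizable on every invariant subspace \<open>W\<close>: pick one
  vector of \<open>W\<close> for each leading basis element that occurs in \<open>W\<close>. This gives one direction, since
  \<open>T\<close> agrees with a triangularizable transformation on each finite-dimensional subspace.

  Conversely, let \<open>W\<close> be finite-dimensional and let \<open>A\<close> be a triangularizing basis of the largest
  invariant subspace of \<open>W\<close>. Extend \<open>A\<close> to a basis \<open>A \<union> C\<close> of \<open>W\<close> such that \<open>A \<union> C \<union> T ` C\<close> is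
  independent and \<open>T\<close> moves each element of \<open>C\<close> along a chain that leaves \<open>W\<close>. The transformation that
  agrees with \<open>T\<close> on \<open>W\<close> and kills all other elements of a basis extending \<open>A \<union> C \<union> T ` C\<close>
  is triangularizable: it is nilpotent modulo the span of \<open>A\<close>.\<close>

subsection \<open>Well-orders\<close>

lemma well_order_onI:
  assumes "r \<subseteq> A \<times> A" "\<And>x. x \<in> A \<Longrightarrow> (x, x) \<in> r"
    and "trans r" "antisym r" "total_on A r" "wf (r - Id)"
  shows "well_order_on A r"
  using assms by (auto simp: order_on_defs refl_on_def)

lemma well_order_on_reflD: "well_order_on B r \<Longrightarrow> v \<in> B \<Longrightarrow> (v, v) \<in> r"
  by (auto simp: order_on_defs refl_on_def)

lemma well_order_on_transD: "well_order_on B r \<Longrightarrow> (u, v) \<in> r \<Longrightarrow> (v, w) \<in> r \<Longrightarrow> (u, w) \<in> r"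
  by (auto simp: order_on_defs intro: transD)

lemma well_order_on_antisymD: "well_order_on B r \<Longrightarrow> (u, v) \<in> r \<Longrightarrow> (v, u) \<in> r \<Longrightarrow> u = v"
  by (auto simp: order_on_defs antisym_def)

lemma well_order_on_totalD:
  "well_order_on B r \<Longrightarrow> u \<in> B \<Longrightarrow> v \<in> B \<Longrightarrow> u \<noteq> v \<Longrightarrow> (u, v) \<in> r \<or> (v, u) \<in> r"
  by (auto simp: order_on_defs total_on_def)

text \<open>Used to find the leading basis element of a linear combination, whose support is finite
  even when \<open>B\<close> is infinite.\<close>

lemma well_order_on_finite_max:
  assumes "well_order_on B r" "finite F" "F \<noteq> {}" "F \<subseteq> B"
  shows "\<exists>m\<in>F. \<forall>u\<in>F. (u, m) \<in> r"
  using assms(2,3,4)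
proof (induction rule: finite_ne_induct)
  case (singleton x)
  then show ?case
    using well_order_on_reflD[OF assms(1)] by auto
next
  case (insert x F)
  then obtain m where m: "m \<in> F" "\<forall>u\<in>F. (u, m) \<in> r"
    by auto
  show ?case
  proof (cases "(x, m) \<in> r")
    case True
    with m show ?thesis
      by auto
  next
    case False
    then have "(m, x) \<in> r"
      using well_order_on_totalD[OF assms(1), of x m] insert.prems m(1) insert.hyps by auto
    then have "(u, x) \<in> r" if "u \<in> insert x F" for u
      using m(2) that insert.prems well_order_on_transD[OF assms(1)] well_order_on_reflD[OF assms(1)]
      by auto
    then show ?thesis
      by auto
  qed
qed

lemma well_order_on_image:
  assumes "well_order_on B r" "L \<subseteq> B" "inj_on f L"
  shows "well_order_on (f ` L) {(f u, f v) | u v. u \<in> L \<and> v \<in> L \<and> (u, v) \<in> r}"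
proof -
  have B: "B = Field r" "Well_order r"
    using well_order_on_Well_order[OF assms(1)] by auto
  then have "well_order_on L (Restr r L)"
    using well_order_on_Restr assms(2) by metis
  then have "well_order_on (f ` L) (dir_image (Restr r L) f)"
    using assms(3)
    by (metis dir_image_Field Well_order_dir_image well_order_on_Well_order)
  also have "dir_image (Restr r L) f = {(f u, f v) | u v. u \<in> L \<and> v \<in> L \<and> (u, v) \<in> r}"
    unfolding dir_image_def by blast
  finally show ?thesis .
qed

text \<open>The order is lexicographic: first the rank \<open>g\<close>, then the given well-order
  of the fibre. A set meeting \<open>B\<close> has a minimal element, found in the fibre of the
  least rank that occurs.\<close>

lemma well_order_on_ranked:
  fixes g :: "'a \<Rightarrow> nat"
  assumes q: "\<And>n. well_order_on {b \<in> B. g b = n} (q n)"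
  shows "well_order_on B {(u, v). u \<in> B \<and> v \<in> B \<and> (g u < g v \<or> g u = g v \<and> (u, v) \<in> q (g u))}"
    (is "well_order_on B ?r")
proof (rule well_order_onI)
  show "?r \<subseteq> B \<times> B"
    by auto
  show "(x, x) \<in> ?r" if "x \<in> B" for x
    using well_order_on_reflD[OF q[of "g x"], of x] that by auto
  show "trans ?r"
    using well_order_on_transD[OF q] by (fastforce intro!: transI)
  show "antisym ?r"
    using well_order_on_antisymD[OF q] by (fastforce intro!: antisymI)
  show "total_on B ?r"
  proof (rule total_onI)
    fix x y
    assume "x \<in> B" "y \<in> B" "x \<noteq> y"
    then show "(x, y) \<in> ?r \<or> (y, x) \<in> ?r"
      using well_order_on_totalD[OF q[of "g x"], of x y] by (cases "g x" "g y" rule: linorder_cases) auto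
  qed
  show "wf (?r - Id)"
  proof (rule wfI_min)
    fix x Q
    assume x: "x \<in> (Q :: 'a set)"
    show "\<exists>z\<in>Q. \<forall>y. (y, z) \<in> ?r - Id \<longrightarrow> y \<notin> Q"
    proof (cases "Q \<inter> B = {}")
      case True
      with x show ?thesis
        by blast
    next
      case False
      then obtain x0 where x0: "x0 \<in> Q \<inter> B"
        by blast
      define n where "n = (LEAST n. \<exists>z\<in>Q \<inter> B. g z = n)"
      obtain z0 where z0: "z0 \<in> Q \<inter> B" "g z0 = n"
        using LeastI[of "\<lambda>n. \<exists>z\<in>Q \<inter> B. g z = n" "g x0"] x0 unfolding n_def by blast
      have le: "n \<le> g z" if "z \<in> Q \<inter> B" for z
        using Least_le[of "\<lambda>n. \<exists>z\<in>Q \<inter> B. g z = n" "g z"] that unfolding n_def by blast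
      have "wf (q n - Id)"
        using q[of n] by (simp add: well_order_on_def)
      then obtain z where z: "z \<in> {z \<in> Q \<inter> B. g z = n}"
        and min: "\<And>y. (y, z) \<in> q n - Id \<Longrightarrow> y \<notin> {z \<in> Q \<inter> B. g z = n}"
        using wfE_min[of "q n - Id" z0 "{z \<in> Q \<inter> B. g z = n}"] z0 by auto
      have "y \<notin> Q" if "(y, z) \<in> ?r - Id" for y
        using that z min[of y] le[of y] by auto
      with z show ?thesis
        by blast
    qed
  qed
qed

subsection \<open>Invariant subspaces of triangularizable transformations\<close>

context vector_space
begin

section \<open>Finite supports, independence and leading terms\<close>

lemma in_span_finite_subset:
  assumes "x \<in> span S"
  shows "\<exists>F. finite F \<and> F \<subseteq> S \<and> x \<in> span F"
proof -
  obtain F u where "finite F" "F \<subseteq> S" "x = (\<Sum>a\<in>F. u a *s a)"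
    using assms unfolding span_explicit by blast
  then show ?thesis
    by (intro exI[of _ F]) (auto intro!: span_sum intro: span_scale span_base)
qed

lemma independent_finite_subsets:
  assumes "\<And>F. finite F \<Longrightarrow> F \<subseteq> B \<Longrightarrow> independent F"
  shows "independent B"
proof
  assume "dependent B"
  then obtain a where a: "a \<in> B" "a \<in> span (B - {a})"
    unfolding dependent_def by blast
  then obtain F where F: "finite F" "F \<subseteq> B - {a}" "a \<in> span F"
    using in_span_finite_subset by meson
  have "insert a F - {a} = F"
    using F(2) by blast
  then have "dependent (insert a F)"
    unfolding dependent_def using F(3) by (intro bexI[of _ a]) auto
  moreover have "independent (insert a F)"
    using F a(1) by (intro assms) auto
  ultimately show False
    by blast
qed

text \<open>In a finite subfamily the largest index contributes a vector outside the span of the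
  others, so finite subfamilies are handled by removing the largest index. A dependence relation
  involves only finitely many vectors.\<close>

lemma independent_well_ordered_family:
  assumes r: "well_order_on B r" and L: "L \<subseteq> B"
    and notin: "\<And>v. v \<in> L \<Longrightarrow> w v \<notin> span (w ` {u \<in> L. (u, v) \<in> r \<and> u \<noteq> v})"
  shows "inj_on w L" "independent (w ` L)"
proof -
  show "inj_on w L"
  proof (rule inj_onI, rule ccontr)
    fix u v
    assume uv: "u \<in> L" "v \<in> L" "w u = w v" "u \<noteq> v"
    then consider "(u, v) \<in> r" | "(v, u) \<in> r"
      using well_order_on_totalD[OF r, of u v] L by auto
    then show False
    proof cases
      case 1
      then have "w u \<in> span (w ` {u \<in> L. (u, v) \<in> r \<and> u \<noteq> v})"
        using uv by (intro span_base) blast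
      with notin[OF uv(2)] uv show False
        by simp
    next
      case 2
      then have "w v \<in> span (w ` {v \<in> L. (v, u) \<in> r \<and> v \<noteq> u})"
        using uv by (intro span_base) blast
      with notin[OF uv(1)] uv show False
        by simp
    qed
  qed
  have fin: "independent (w ` F)" if "finite F" "F \<subseteq> L" for F
    using that
  proof (induction "card F" arbitrary: F)
    case 0
    then show ?case
      by (simp add: independent_empty)
  next
    case (Suc n)
    then have "F \<noteq> {}" "F \<subseteq> B"
      using L by auto
    then obtain m where m: "m \<in> F" "\<forall>u\<in>F. (u, m) \<in> r"
      using well_order_on_finite_max[OF r Suc.prems(1)] by blast
    have "independent (w ` (F - {m}))"
      using Suc m(1) by (intro Suc.hyps(1)) auto
    moreover have "w m \<notin> span (w ` (F - {m}))"
    proof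
      assume "w m \<in> span (w ` (F - {m}))"
      moreover have "w ` (F - {m}) \<subseteq> w ` {u \<in> L. (u, m) \<in> r \<and> u \<noteq> m}"
        using m(2) Suc.prems(2) by auto
      ultimately show False
        using notin[of m] m(1) Suc.prems(2) span_mono by blast
    qed
    ultimately have "independent (insert (w m) (w ` (F - {m})))"
      by (simp add: independent_insert)
    also have "insert (w m) (w ` (F - {m})) = w ` F"
      using m(1) by blast
    finally show ?case .
  qed
  show "independent (w ` L)"
  proof (rule independent_finite_subsets)
    fix G
    assume "finite G" "G \<subseteq> w ` L"
    then obtain F where "F \<subseteq> L" "finite F" "G = w ` F"
      by (meson finite_subset_image)
    then show "independent G"
      using fin by simp
  qed
qed

lemma linear_imp_span_image:
  assumes "Vector_Spaces.linear scale scale T" "x \<in> span S" "T ` S \<subseteq> span S'"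
  shows "T x \<in> span S'"
proof -
  interpret vector_space_pair scale scale ..
  have "T x \<in> T ` span S"
    using assms(2) by blast
  also have "\<dots> = span (T ` S)"
    using linear_span_image[OF assms(1)] by simp
  also have "\<dots> \<subseteq> span S'"
    using span_minimal[OF assms(3)] by simp
  finally show ?thesis .
qed

text \<open>Gaussian elimination along a well-ordered basis: \<open>W\<close> is filtered by the
  spans of initial segments, and one vector is kept for each \<open>v\<close> at which the
  filtration grows. \<open>T\<close> preserves both \<open>W\<close> and the filtration.\<close>

lemma triangularizable_on_subspace:
  assumes T: "Vector_Spaces.linear scale scale T" and tri: "triangularizable_on scale U T"
    and W: "invariant_subspace scale T W" "W \<subseteq> U"
  shows "triangularizable_on scale W T"
proof -
  obtain B r where B: "basis_of scale B U" and r: "well_order_on B r" and tri: "triangular scale B r T"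
    using tri unfolding triangularizable_on_def by blast
  have sW: "subspace W" and inv: "T ` W \<subseteq> W"
    using W(1) by (auto simp: invariant_subspace_def)
  note trans = well_order_on_transD[OF r] and dom = well_order_on_domain[OF r]
  \<comment> \<open>Closed and open initial segments at \<open>v\<close>. A vector in
    \<open>span (below v)\<close> but not in \<open>span (sbelow v)\<close> has leading element
    \<open>v\<close>.\<close>
  define below where "below v = {u \<in> B. (u, v) \<in> r}" for v
  define sbelow where "sbelow v = {u \<in> B. (u, v) \<in> r \<and> u \<noteq> v}" for v
  have below_eq: "below v = insert v (sbelow v)" if "v \<in> B" for v
    using that well_order_on_reflD[OF r] by (auto simp: below_def sbelow_def)
  have below_mono: "below u \<subseteq> below v" if "(u, v) \<in> r" for u v
    using that trans by (auto simp: below_def)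
  have below_sbelow: "below u \<subseteq> sbelow v" if "(u, v) \<in> r" "u \<noteq> v" for u v
    using that trans well_order_on_antisymD[OF r] by (auto simp: below_def sbelow_def)
  have T_below: "T x \<in> span (below v)" if "x \<in> span (below v)" for x v
  proof (rule linear_imp_span_image[OF T that])
    show "T ` below v \<subseteq> span (below v)"
      using tri span_mono[OF below_mono] unfolding triangular_def below_def by blast
  qed
  \<comment> \<open>A combination of elements strictly below \<open>v\<close> has a largest term
    \<open>u\<close>, even if \<open>v\<close> has no immediate predecessor. Zero is treated apart
    because \<open>sbelow v\<close> may be empty.\<close>
  have sbelow_cases: "x = 0 \<or> (\<exists>u. (u, v) \<in> r \<and> u \<noteq> v \<and> x \<in> span (below u))"
    if x: "x \<in> span (sbelow v)" for x v
  proof -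
    obtain F where F: "finite F" "F \<subseteq> sbelow v" "x \<in> span F"
      using in_span_finite_subset[OF x] by blast
    show ?thesis
    proof (cases "F = {}")
      case True
      with F(3) show ?thesis
        by simp
    next
      case False
      then obtain m where m: "m \<in> F" "\<forall>u\<in>F. (u, m) \<in> r"
        using well_order_on_finite_max[OF r F(1)] F(2) by (auto simp: sbelow_def)
      then have "F \<subseteq> below m"
        using dom by (auto simp: below_def)
      then have "x \<in> span (below m)"
        using F(3) span_mono by blast
      with m(1) F(2) show ?thesis
        by (auto simp: sbelow_def)
    qed
  qed
  \<comment> \<open>The leading elements that occur in \<open>W\<close>; below, \<open>w\<close>
    picks a vector of \<open>W\<close> for each of them.\<close>
  define L where "L = {v \<in> B. \<exists>x\<in>W. x \<in> span (below v) \<and> x \<notin> span (sbelow v)}"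
  have "\<forall>v\<in>L. \<exists>x. x \<in> W \<and> x \<in> span (below v) \<and> x \<notin> span (sbelow v)"
    unfolding L_def by blast
  then obtain w where w: "\<And>v. v \<in> L \<Longrightarrow> w v \<in> W \<and> w v \<in> span (below v) \<and> w v \<notin> span (sbelow v)"
    using bchoice by metis
  have L: "L \<subseteq> B"
    by (auto simp: L_def)
  have notin: "w v \<notin> span (w ` {u \<in> L. (u, v) \<in> r \<and> u \<noteq> v})" if v: "v \<in> L" for v
  proof -
    have "w ` {u \<in> L. (u, v) \<in> r \<and> u \<noteq> v} \<subseteq> span (sbelow v)"
      using w span_mono[OF below_sbelow] by blast
    then have "span (w ` {u \<in> L. (u, v) \<in> r \<and> u \<noteq> v}) \<subseteq> span (sbelow v)"
      by (rule span_minimal) simp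
    then show ?thesis
      using w[OF v] by blast
  qed
  note indep = independent_well_ordered_family[OF r L, of w, OF notin]
  have wf: "wf (r - Id)"
    using r by (simp add: well_order_on_def)
  \<comment> \<open>Elimination by well-founded induction on the bound \<open>v\<close>: once the
    term at \<open>v\<close> is removed, the remainder is zero or bounded by a smaller
    element.\<close>
  have gen: "v \<in> B \<Longrightarrow> x \<in> W \<Longrightarrow> x \<in> span (below v) \<Longrightarrow> x \<in> span (w ` {u \<in> L. (u, v) \<in> r})" for v x
    using wf
  proof (induction v arbitrary: x rule: wf_induct_rule)
    case (less v)
    have sb: "y \<in> span (w ` {u \<in> L. (u, v) \<in> r})" if y: "y \<in> W" "y \<in> span (sbelow v)" for y
      using sbelow_cases[OF y(2)]
    proof
      assume "y = 0"
      then show ?thesis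
        by (simp add: span_zero)
    next
      assume "\<exists>u. (u, v) \<in> r \<and> u \<noteq> v \<and> y \<in> span (below u)"
      then obtain u where u: "(u, v) \<in> r" "u \<noteq> v" "y \<in> span (below u)"
        by blast
      then have "y \<in> span (w ` {x \<in> L. (x, u) \<in> r})"
        using less.IH[of u y] y(1) dom by auto
      moreover have "w ` {x \<in> L. (x, u) \<in> r} \<subseteq> w ` {u \<in> L. (u, v) \<in> r}"
        using u(1) trans by blast
      ultimately show ?thesis
        using span_mono by blast
    qed
    show ?case
    proof (cases "v \<in> L")
      case False
      then have "x \<in> span (sbelow v)"
        using less.prems by (auto simp: L_def)
      with sb less.prems(2) show ?thesis
        by blast
    next
      case True
      have bi: "below v = insert v (sbelow v)"
        using below_eq less.prems(1) by blast
      obtain a where a: "w v - scale a v \<in> span (sbelow v)"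
        using w[OF True] unfolding bi span_breakdown_eq by blast
      obtain b where b: "x - scale b v \<in> span (sbelow v)"
        using less.prems(3) unfolding bi span_breakdown_eq by blast
      have "a \<noteq> 0"
        using a w[OF True] by auto
      \<comment> \<open>\<open>a\<close> and \<open>b\<close> are the coefficients of
        \<open>v\<close> in \<open>w v\<close> and in \<open>x\<close>; this combination cancels
        them and stays in \<open>W\<close>.\<close>
      define y where "y = x - scale (b / a) (w v)"
      have "y = (x - scale b v) - scale (b / a) (w v - scale a v)"
        using \<open>a \<noteq> 0\<close> by (simp add: y_def scale_right_diff_distrib)
      then have "y \<in> span (sbelow v)"
        using a b by (simp add: span_diff span_scale)
      moreover have "y \<in> W"
        unfolding y_def using w[OF True] less.prems(2) sW by (simp add: subspace_diff subspace_scale)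
      ultimately have "y \<in> span (w ` {u \<in> L. (u, v) \<in> r})"
        by (rule sb[rotated])
      moreover have "w v \<in> span (w ` {u \<in> L. (u, v) \<in> r})"
        using True L well_order_on_reflD[OF r] by (intro span_base) auto
      moreover have "x = y + scale (b / a) (w v)"
        by (simp add: y_def)
      ultimately show ?thesis
        by (simp add: span_add span_scale)
    qed
  qed
  have "span (w ` L) = W"
  proof (rule span_subspace[OF _ _ sW])
    show "w ` L \<subseteq> W"
      using w by blast
    show "W \<subseteq> span (w ` L)"
    proof
      fix x
      assume x: "x \<in> W"
      then have "x \<in> span B"
        using W(2) B by (auto simp: basis_of_def)
      then obtain F where F: "finite F" "F \<subseteq> B" "x \<in> span F"
        using in_span_finite_subset by meson
      show "x \<in> span (w ` L)"
      proof (cases "F = {}")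
        case True
        with F show ?thesis
          by (simp add: span_zero)
      next
        case False
        then obtain m where m: "m \<in> F" "\<forall>u\<in>F. (u, m) \<in> r"
          using well_order_on_finite_max[OF r F(1)] F(2) by auto
        then have "F \<subseteq> below m"
          using F(2) by (auto simp: below_def)
        then have "x \<in> span (w ` {u \<in> L. (u, m) \<in> r})"
          using F m x span_mono by (intro gen) blast+
        then show ?thesis
          using span_mono[of "w ` {u \<in> L. (u, m) \<in> r}" "w ` L"] by blast
      qed
    qed
  qed
  then have "basis_of scale (w ` L) W"
    using indep(2) by (simp add: basis_of_def)
  moreover have "well_order_on (w ` L) {(w u, w v) | u v. u \<in> L \<and> v \<in> L \<and> (u, v) \<in> r}"
    (is "well_order_on _ ?q") by (rule well_order_on_image[OF r L indep(1)])
  moreover have "triangular scale (w ` L) ?q T"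
    unfolding triangular_def
  proof safe
    fix v
    assume v: "v \<in> L"
    \<comment> \<open>The image lies in \<open>W\<close> and in \<open>span (below v)\<close>, so
      \<open>gen\<close> expands it in chosen vectors of index at most \<open>v\<close>.\<close>
    have "T (w v) \<in> span (w ` {u \<in> L. (u, v) \<in> r})"
      using w[OF v] inv L v by (intro gen T_below) auto
    moreover have "w ` {u \<in> L. (u, v) \<in> r} \<subseteq> {u \<in> w ` L. (u, w v) \<in> ?q}"
      using v by blast
    ultimately show "T (w v) \<in> span {u \<in> w ` L. (u, w v) \<in> ?q}"
      using span_mono by blast
  qed
  ultimately show ?thesis
    unfolding triangularizable_on_def by blast
qed

subsection \<open>Triangularizable extensions\<close>

text \<open>\<open>A\<close> is placed below \<open>D\<close>, and \<open>D\<close> is ordered by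
  the rank \<open>h\<close>. Within one rank any well-order will do: besides \<open>A\<close> and
  \<open>v\<close> itself, \<open>T v\<close> involves only elements of smaller rank.\<close>

lemma triangular_extend:
  fixes h :: "'b \<Rightarrow> nat"
  assumes r: "well_order_on A r" and tri: "triangular scale A r T" and disj: "A \<inter> D = {}"
    and D: "\<And>v. v \<in> D \<Longrightarrow> T v \<in> span (insert v (A \<union> {u \<in> D. h u < h v}))"
  shows "\<exists>q. well_order_on (A \<union> D) q \<and> triangular scale (A \<union> D) q T"
proof -
  \<comment> \<open>The shift by \<open>Suc\<close> reserves rank 0 for \<open>A\<close>, which
    keeps its order \<open>r\<close>.\<close>
  define g where "g b = (if b \<in> A then 0 else Suc (h b))" for b
  have fib0: "{b \<in> A \<union> D. g b = 0} = A"
    by (auto simp: g_def)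
  have "\<exists>s. well_order_on {b \<in> A \<union> D. g b = n} s \<and> (n = 0 \<longrightarrow> s = r)" for n
    using well_order_on[of "{b \<in> A \<union> D. g b = n}"] r fib0 by (cases "n = 0") auto
  then obtain s where s: "\<And>n. well_order_on {b \<in> A \<union> D. g b = n} (s n)" and s0: "s 0 = r"
    by metis
  define q where
    "q = {(u, v). u \<in> A \<union> D \<and> v \<in> A \<union> D \<and> (g u < g v \<or> g u = g v \<and> (u, v) \<in> s (g u))}"
  have q: "well_order_on (A \<union> D) q"
    unfolding q_def by (rule well_order_on_ranked[OF s])
  moreover have "T v \<in> span {u \<in> A \<union> D. (u, v) \<in> q}" if v: "v \<in> A \<union> D" for v
  proof (cases "v \<in> A")
    case True
    then have "T v \<in> span {u \<in> A. (u, v) \<in> r}"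
      using tri by (simp add: triangular_def)
    moreover have "{u \<in> A. (u, v) \<in> r} \<subseteq> {u \<in> A \<union> D. (u, v) \<in> q}"
      using True by (auto simp: q_def g_def s0)
    ultimately show ?thesis
      using span_mono by blast
  next
    case False
    then have "T v \<in> span (insert v (A \<union> {u \<in> D. h u < h v}))"
      using v by (intro D) blast
    moreover have "insert v (A \<union> {u \<in> D. h u < h v}) \<subseteq> {u \<in> A \<union> D. (u, v) \<in> q}"
      using False v disj well_order_on_reflD[OF q v] by (auto simp: q_def g_def)
    ultimately show ?thesis
      using span_mono by blast
  qed
  ultimately show ?thesis
    unfolding triangular_def by blast
qed

section \<open>Bases adapted to chains that leave a subspace\<close>

text \<open>As \<open>span E\<close> meets \<open>span X\<close> only in zero, the last hypothesis
  makes \<open>T\<close> injective from \<open>span E\<close> to the quotient by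
  \<open>span B\<close>. Hence the images of \<open>E\<close> are independent modulo
  \<open>span B\<close>.\<close>

lemma independent_Un_image:
  assumes T: "Vector_Spaces.linear scale scale T"
    and "finite E" "independent (X \<union> E)" "X \<inter> E = {}" "independent B"
    and "\<And>x. x \<in> span E \<Longrightarrow> T x \<in> span B \<Longrightarrow> x \<in> span X"
  shows "independent (B \<union> T ` E) \<and> inj_on T E \<and> B \<inter> T ` E = {}"
  using assms(2-)
proof (induction E rule: finite_induct)
  case empty
  then show ?case
    by simp
next
  case (insert e E)
  interpret vector_space_pair scale scale ..
  have "span E \<subseteq> span (insert e E)"
    by (rule span_mono) blast
  then have IH: "independent (B \<union> T ` E)" "inj_on T E" "B \<inter> T ` E = {}"
    using insert.IH insert.prems independent_mono[of "X \<union> insert e E" "X \<union> E"] by blast+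
  have e: "e \<notin> span (X \<union> E)"
    using insert.prems(1,2) insert.hyps by (auto simp: independent_insert split: if_splits)
  have new: "T e \<notin> span (B \<union> T ` E)"
  proof
    assume "T e \<in> span (B \<union> T ` E)"
    \<comment> \<open>Then \<open>e - x\<close> is mapped into \<open>span B\<close>, hence lies in
      \<open>span X\<close>, and \<open>e\<close> would depend on \<open>X\<close> and
      \<open>E\<close>.\<close>
    then obtain b x where bx: "b \<in> span B" "x \<in> span E" "T e = b + T x"
      unfolding span_Un linear_span_image[OF T] by blast
    have "x \<in> span (insert e E)" "e \<in> span (insert e E)"
      using bx(2) span_mono[of E "insert e E"] span_base[of e "insert e E"] by blast+
    then have "e - x \<in> span (insert e E)"
      by (simp add: span_diff)
    moreover have "T (e - x) = b"
      using bx(3) linear_diff[OF T] by simp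
    ultimately have "e - x \<in> span X"
      using insert.prems(4) bx(1) by blast
    then have "(e - x) + x \<in> span (X \<union> E)"
      using bx(2) span_mono[of X "X \<union> E"] span_mono[of E "X \<union> E"] by (intro span_add) blast+
    with e show False
      by simp
  qed
  then have "T e \<notin> B \<union> T ` E"
    using span_base[of "T e" "B \<union> T ` E"] by blast
  then show ?case
    using new IH by (auto simp: independent_insert)
qed

text \<open>The basis is built upwards along \<open>W \<supseteq> {w \<in> W. T w \<in> W} \<supseteq> \<dots> \<supseteq> span A\<close>, since \<open>T\<close>
  induces injections between successive quotients of this sequence of subspaces.\<close>

lemma exists_chain_basis:
  assumes T: "Vector_Spaces.linear scale scale T"
    and A: "independent A" "invariant_subspace scale T (span A)"
    and "subspace W" "finite G" "W \<subseteq> span G" "span A \<subseteq> W"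
    and "\<And>U. invariant_subspace scale T U \<Longrightarrow> U \<subseteq> W \<Longrightarrow> U \<subseteq> span A"
  shows "\<exists>C (h :: 'b \<Rightarrow> nat). span (A \<union> C) = W \<and> independent (A \<union> C \<union> T ` C) \<and>
    A \<inter> C = {} \<and> A \<inter> T ` C = {} \<and> inj_on T C \<and> (\<forall>c\<in>C. h (T c) < h c)"
  using assms(4-)
proof (induction "card G" arbitrary: W G rule: less_induct)
  case less
  interpret vector_space_pair scale scale ..
  have inv: "T ` span A \<subseteq> span A"
    using A(2) by (simp add: invariant_subspace_def)
  \<comment> \<open>The vectors that remain in \<open>W\<close> after one application of
    \<open>T\<close>. If these are all of \<open>W\<close>, then \<open>W\<close> is invariant, so
    it equals \<open>span A\<close> and \<open>C\<close> is empty.\<close>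
  define W1 where "W1 = {w \<in> W. T w \<in> W}"
  have sW1: "subspace W1"
    using less.prems(1) linear_add[OF T] linear_scale[OF T] linear_0[OF T]
    unfolding subspace_def W1_def by simp
  show ?case
  proof (cases "W1 = W")
    case True
    then have "W \<subseteq> span A"
      using less.prems(1) by (intro less.prems(5)) (auto simp: invariant_subspace_def W1_def)
    then have "span A = W"
      using less.prems(4) by blast
    then show ?thesis
      using A(1) by (intro exI[of _ "{}"]) auto
  next
    case False
    obtain G1 where G1: "G1 \<subseteq> W1" "independent G1" "W1 \<subseteq> span G1"
      using maximal_independent_subset by blast
    have "span G1 \<subseteq> W1"
      using G1(1) sW1 by (rule span_minimal)
    then obtain x where x: "x \<in> W" "x \<notin> span G1"
      using False by (auto simp: W1_def)
    then have "independent (insert x G1)" "x \<notin> G1"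
      using G1(2) span_base by (auto simp: independent_insert)
    moreover have "insert x G1 \<subseteq> span G"
      using x(1) G1(1) less.prems(3) by (auto simp: W1_def)
    \<comment> \<open>Adding \<open>x\<close> to the basis \<open>G1\<close> of \<open>W1\<close>
      gives an independent set inside \<open>span G\<close>, so \<open>G1\<close> is strictly
      smaller than \<open>G\<close> and the induction hypothesis applies to
      \<open>W1\<close>.\<close>
    ultimately have fin: "finite G1" "card G1 < card G"
      using independent_span_bound[OF less.prems(2), of "insert x G1"] by auto
    have AW1: "span A \<subseteq> W1"
      using less.prems(4) inv by (auto simp: W1_def)
    have "W1 \<subseteq> W"
      by (auto simp: W1_def)
    then have "U \<subseteq> span A" if "invariant_subspace scale T U" "U \<subseteq> W1" for U
      using less.prems(5) that by blast
    then obtain C1 and h1 :: "'b \<Rightarrow> nat" where C1: "span (A \<union> C1) = W1" "independent (A \<union> C1 \<union> T ` C1)"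
      "A \<inter> C1 = {}" "A \<inter> T ` C1 = {}" "inj_on T C1" "\<forall>c\<in>C1. h1 (T c) < h1 c"
      using less.hyps[OF fin(2) sW1 fin(1) G1(3) AW1] by metis
    have C1W: "A \<union> C1 \<subseteq> W1"
      using C1(1) span_superset by blast
    then have "A \<union> C1 \<union> T ` C1 \<subseteq> W"
      by (auto simp: W1_def)
    then obtain B where B: "A \<union> C1 \<union> T ` C1 \<subseteq> B" "B \<subseteq> W" "independent B" "W \<subseteq> span B"
      using maximal_independent_subset_extend C1(2) by metis
    have spB: "span B = W"
      using B less.prems(1) by (intro span_subspace)
    define C where "C = B - A"
    \<comment> \<open>\<open>E\<close> spans a complement of \<open>W1\<close> in \<open>W\<close>,
      so \<open>T\<close> moves its elements out of \<open>W\<close> at once.\<close>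
    define E where "E = C - C1"
    \<comment> \<open>Rank 0 outside \<open>W\<close> makes the rank drop when \<open>T\<close>
      moves an element of \<open>E\<close> out of \<open>W\<close>; adding one on \<open>W\<close>
      preserves the strict decrease along \<open>C1\<close>.\<close>
    define h where "h x = (if x \<in> W then Suc (h1 x) else 0)" for x
    have B_eq: "B = A \<union> C" "B = (A \<union> C1) \<union> E"
      using B(1) C1(3) by (auto simp: C_def E_def)
    have C_eq: "C = C1 \<union> E" and TC1: "T ` C1 \<subseteq> C"
      using B(1) C1(3,4) by (auto simp: C_def E_def)
    have "finite B"
      using independent_span_bound[OF less.prems(2) B(3)] B(2) less.prems(3) by blast
    then have "finite E"
      by (auto simp: E_def C_def)
    \<comment> \<open>If \<open>x\<close> and \<open>T x\<close> both lie in \<open>W\<close>, then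
      \<open>x\<close> lies in \<open>W1\<close>. This is the injectivity hypothesis of
      \<open>independent_Un_image\<close>.\<close>
    moreover have "x \<in> span (A \<union> C1)" if "x \<in> span E" "T x \<in> span B" for x
      using that span_mono[of E B] B_eq(2) unfolding C1(1) W1_def spB by blast
    moreover have "(A \<union> C1) \<inter> E = {}"
      by (auto simp: E_def C_def)
    ultimately have *: "independent (B \<union> T ` E)" "inj_on T E" "B \<inter> T ` E = {}"
      using independent_Un_image[OF T, of E "A \<union> C1" B] B(3) B_eq(2) by metis+
    have "A \<union> C \<union> T ` C = B \<union> T ` E"
      using B_eq(1) C_eq TC1 by blast
    then have "independent (A \<union> C \<union> T ` C)"
      using *(1) by simp
    moreover have "A \<inter> T ` C = {}"
      using C1(4) *(3) B_eq(1) C_eq by blast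
    moreover have "inj_on T C"
      unfolding C_eq using C1(5) *(2,3) TC1 B_eq(1) by (auto simp: inj_on_Un)
    moreover have "h (T c) < h c" if c: "c \<in> C" for c
    proof (cases "c \<in> C1")
      case True
      then have "c \<in> W" "T c \<in> W"
        using C1W by (auto simp: W1_def)
      then show ?thesis
        using C1(6) True by (simp add: h_def)
    next
      case False
      then have cE: "c \<in> E"
        using c by (simp add: E_def)
      have cW: "c \<in> W"
        using c B_eq(1) B(2) by blast
      \<comment> \<open>Together with the basis \<open>B\<close> of \<open>W\<close>, the further
        vector \<open>T c\<close> is still independent.\<close>
      have "T c \<notin> W"
      proof
        assume "T c \<in> W"
        then have "T c \<in> span B"
          using spB by simp
        moreover have "independent (insert (T c) B)"
          using cE by (intro independent_mono[OF *(1)]) auto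
        moreover have "T c \<notin> B"
          using *(3) cE by blast
        ultimately show False
          by (simp add: independent_insert)
      qed
      then show ?thesis
        using cW by (simp add: h_def)
    qed
    moreover have "span (A \<union> C) = W"
      using spB B_eq(1) by metis
    moreover have "A \<inter> C = {}"
      by (auto simp: C_def)
    ultimately show ?thesis
      by blast
  qed
qed

text \<open>Supplies the approximants for the closure. The hypothesis on invariant subspaces is
  applied to the largest one inside \<open>W\<close>.\<close>

lemma triangularizable_extension:
  assumes T: "Vector_Spaces.linear scale scale T" and W: "finite_dim_subspace scale W"
    and tri: "\<And>U. finite_dim_subspace scale U \<Longrightarrow> invariant_subspace scale T U \<Longrightarrow>
      triangularizable_on scale U T"
  shows "\<exists>S\<in>triangularizables scale. \<forall>w\<in>W. S w = T w"
proof -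
  interpret vector_space_pair scale scale ..
  obtain G where G: "finite G" "span G = W"
    using W by (auto simp: finite_dim_subspace_def basis_of_def)
  then have sW: "subspace W"
    using subspace_span by blast
  \<comment> \<open>Vectors whose whole orbit stays in \<open>W\<close>. Every invariant subspace
    inside \<open>W\<close> is contained in \<open>U\<close>, which is itself invariant.\<close>
  define U where "U = {w. \<forall>n. (T ^^ n) w \<in> W}"
  have UW: "U \<subseteq> W"
    unfolding U_def using funpow_0 by (metis (mono_tags, lifting) mem_Collect_eq subsetI)
  have lin: "Vector_Spaces.linear scale scale (T ^^ n)" for n
  proof (induction n)
    case 0
    then show ?case
      using linear_id by (simp add: id_def)
  next
    case (Suc n)
    then show ?case
      using Vector_Spaces.linear_compose[OF _ T] by (simp add: comp_def)
  qed
  have sU: "subspace U"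
    unfolding subspace_def U_def
    using sW by (simp add: linear_0[OF lin] linear_add[OF lin] linear_scale[OF lin] subspace_0 subspace_add subspace_scale)
  have "T ` U \<subseteq> U"
  proof
    fix y
    assume "y \<in> T ` U"
    then obtain x where x: "\<And>n. (T ^^ n) x \<in> W" "y = T x"
      unfolding U_def by blast
    have "(T ^^ n) y \<in> W" for n
      using x(1)[of "Suc n"] x(2) by (simp add: funpow_swap1)
    then show "y \<in> U"
      by (simp add: U_def)
  qed
  then have invU: "invariant_subspace scale T U"
    using sU by (simp add: invariant_subspace_def)
  have maxU: "U' \<subseteq> U" if U': "invariant_subspace scale T U'" "U' \<subseteq> W" for U'
  proof
    fix x
    assume x: "x \<in> U'"
    have "(T ^^ n) x \<in> U'" for n
      using x U'(1) by (induction n) (auto simp: invariant_subspace_def)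
    then show "x \<in> U"
      using U'(2) by (auto simp: U_def)
  qed
  obtain A0 where A0: "A0 \<subseteq> U" "independent A0" "U \<subseteq> span A0"
    using maximal_independent_subset by blast
  have "finite A0"
    using independent_span_bound[OF G(1) A0(2)] A0(1) UW G(2) by blast
  moreover have "span A0 = U"
    using A0 sU by (intro span_subspace)
  ultimately have "finite_dim_subspace scale U"
    using finite_dim_subspace_span by blast
  then obtain A r where "basis_of scale A U" and r: "well_order_on A r" "triangular scale A r T"
    using tri invU unfolding triangularizable_on_def by blast
  then have A: "independent A" "span A = U"
    by (auto simp: basis_of_def)
  obtain C and h :: "'b \<Rightarrow> nat" where C: "span (A \<union> C) = W" "independent (A \<union> C \<union> T ` C)"
      "A \<inter> C = {}" "\<forall>c\<in>C. h (T c) < h c"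
    using exists_chain_basis[OF T A(1) _ sW G(1)] maxU G(2) UW A(2) invU by (metis order_refl)
  obtain B where B: "A \<union> C \<union> T ` C \<subseteq> B" "independent B" "UNIV \<subseteq> span B"
    using maximal_independent_subset_extend[OF subset_UNIV C(2)] by metis
  \<comment> \<open>\<open>S\<close> follows \<open>T\<close> on \<open>A\<close> and
    \<open>C\<close>. If \<open>T c\<close> lies outside both, it is still an element of
    \<open>B\<close>, so \<open>S\<close> kills it and the chain ends there.\<close>
  obtain S where S: "Vector_Spaces.linear scale scale S" "\<And>b. b \<in> B \<Longrightarrow> S b = (if b \<in> A \<union> C then T b else 0)"
    using linear_independent_extend[OF B(2), of "\<lambda>b. if b \<in> A \<union> C then T b else 0"] by blast
  have S_eq: "S b = T b" if "b \<in> A \<union> C" for b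
    using S(2)[of b] B(1) that by auto
  then have agree: "S w = T w" if "w \<in> W" for w
    using linear_eq_on[OF S(1) T, of w "A \<union> C"] C(1) that by blast
  have "triangular scale A r S"
    using r(2) S_eq by (simp add: triangular_def)
  \<comment> \<open>On \<open>B - A\<close>, \<open>S\<close> maps an element of \<open>C\<close> to
    a basis element in \<open>A\<close> or of smaller rank, and everything else to zero.\<close>
  then obtain q where q: "well_order_on (A \<union> (B - A)) q" "triangular scale (A \<union> (B - A)) q S"
  proof (rule exE[OF triangular_extend[OF r(1), where D = "B - A" and h = h]])
    fix v
    assume v: "v \<in> B - A"
    show "S v \<in> span (insert v (A \<union> {u \<in> B - A. h u < h v}))"
    proof (cases "v \<in> C")
      case True
      then have "T v \<in> A \<union> {u \<in> B - A. h u < h v}"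
        using B(1) C(4) by auto
      then show ?thesis
        using S_eq True by (intro span_base) auto
    next
      case False
      then show ?thesis
        using S(2) v by (simp add: span_zero)
    qed
  qed auto
  have "A \<union> (B - A) = B" "span B = UNIV"
    using B(1,3) by blast+
  then have "triangularizable_on scale UNIV S"
    using q B(2) unfolding triangularizable_on_def basis_of_def by metis
  then show ?thesis
    using S(1) agree unfolding triangularizables_def End_space_def by blast
qed

end
subsection \<open>Algebraically closed fields\<close>

text \<open>This is \<open>p(T) w\<close>, evaluated by Horner's rule.\<close>

definition poly_apply :: "('k::field, 'v::ab_group_add) scaling \<Rightarrow> ('v \<Rightarrow> 'v) \<Rightarrow> 'k poly \<Rightarrow> 'v \<Rightarrow> 'v"
  where "poly_apply sc T p w = fold_coeffs (\<lambda>a y. sc a w + T y) p 0"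

context vector_space
begin

lemma poly_apply_0 [simp]: "poly_apply scale T 0 w = 0"
  by (simp add: poly_apply_def)

context
  fixes T :: "'b \<Rightarrow> 'b"
  assumes T: "Vector_Spaces.linear scale scale T"
begin

interpretation T: module_hom scale scale T
  using T by (simp add: module_hom_iff_linear)

lemma poly_apply_pCons [simp]: "poly_apply scale T (pCons a p) w = scale a w + T (poly_apply scale T p w)"
  by (cases "a = 0 \<and> p = 0") (auto simp: poly_apply_def T.zero)

lemma poly_apply_add: "poly_apply scale T (p + q) w = poly_apply scale T p w + poly_apply scale T q w"
  by (induction p q rule: poly_induct2) (simp_all add: scale_left_distrib T.add)

lemma poly_apply_smult: "poly_apply scale T (smult a p) w = scale a (poly_apply scale T p w)"
  by (induction p) (simp_all add: scale_right_distrib T.scale)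

lemma poly_apply_minus: "poly_apply scale T (p - q) w = poly_apply scale T p w - poly_apply scale T q w"
  using poly_apply_add[of p "smult (- 1) q" w] poly_apply_smult[of "- 1" q w] by simp

lemma poly_apply_sum: "poly_apply scale T (\<Sum>i\<in>I. f i) w = (\<Sum>i\<in>I. poly_apply scale T (f i) w)"
  by (induction I rule: infinite_finite_induct) (simp_all add: poly_apply_add)

lemma poly_apply_monom: "poly_apply scale T (monom a n) w = scale a ((T ^^ n) w)"
  by (induction n) (simp_all add: monom_0 monom_Suc T.zero T.scale)

lemma poly_apply_linear_mult:
  "poly_apply scale T ([:- a, 1:] * q) w = T (poly_apply scale T q w) - scale a (poly_apply scale T q w)"
  by (simp add: poly_apply_minus poly_apply_smult)

lemma poly_apply_in_subspace:
  assumes "subspace W" "T ` W \<subseteq> W" "w \<in> W"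
  shows "poly_apply scale T p w \<in> W"
  using assms by (induction p) (auto simp: subspace_0 subspace_add subspace_scale)

text \<open>The vectors \<open>(T ^^ i) w\<close> for \<open>i\<close> up to \<open>card G\<close>
  are one too many to be distinct and independent in \<open>span G\<close>; a linear relation among
  them is the polynomial.\<close>

lemma exists_annihilating_poly:
  assumes "finite G" "T ` span G \<subseteq> span G" "w \<in> span G"
  shows "\<exists>p. p \<noteq> 0 \<and> poly_apply scale T p w = 0"
proof -
  define v where "v i = (T ^^ i) w" for i
  have v: "v i \<in> span G" for i
    unfolding v_def using assms(2,3) by (induction i) auto
  define I where "I = {..card G}"
  show ?thesis
  \<comment> \<open>A repetition shrinks the image of \<open>I\<close> and defeats the counting, but
    gives a difference of two monomials directly.\<close>
  proof (cases "inj_on v I")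
    case False
    then obtain i j where ij: "i \<noteq> j" "v i = v j"
      by (auto simp: inj_on_def)
    define p where "p = monom (1 :: 'a) i - monom 1 j"
    have "coeff p i = 1"
      using ij(1) by (simp add: p_def)
    then have "p \<noteq> 0"
      by auto
    moreover have "poly_apply scale T p w = 0"
      using ij(2) by (simp add: p_def poly_apply_minus poly_apply_monom v_def)
    ultimately show ?thesis
      by blast
  next
    case True
    then have "card (v ` I) = Suc (card G)"
      by (simp add: card_image I_def)
    then have "dependent (v ` I)"
      using independent_span_bound[OF assms(1), of "v ` I"] v by force
    moreover have "finite (v ` I)"
      by (simp add: I_def)
    ultimately obtain u where u: "\<exists>x\<in>v ` I. u x \<noteq> 0" "(\<Sum>x\<in>v ` I. scale (u x) x) = 0"
      using dependent_finite by blast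
    define p where "p = (\<Sum>i\<in>I. monom (u (v i)) i)"
    have "poly_apply scale T p w = (\<Sum>i\<in>I. scale (u (v i)) (v i))"
      by (simp add: p_def poly_apply_sum poly_apply_monom v_def)
    also have "\<dots> = 0"
      using u(2) True by (simp add: sum.reindex)
    finally have "poly_apply scale T p w = 0" .
    moreover obtain i where i: "i \<in> I" "u (v i) \<noteq> 0"
      using u(1) by blast
    have "coeff p i = u (v i)"
      using i(1) by (simp add: p_def coeff_sum I_def)
    then have "p \<noteq> 0"
      using i(2) by auto
    ultimately show ?thesis
      by blast
  qed
qed

section \<open>Eigenvectors modulo a subspace\<close>

text \<open>Take a nonzero \<open>p\<close> of least degree with \<open>p(T) w\<close> in
  \<open>U\<close>. It is not constant, as \<open>w\<close> is outside \<open>U\<close>, so it has a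
  root \<open>a\<close> and a factor \<open>q\<close> of smaller degree; by minimality
  \<open>q(T) w\<close> is outside \<open>U\<close>, and it is an eigenvector modulo
  \<open>U\<close>.\<close>

lemma exists_eigenvector_mod_subspace:
  assumes ac: "algebraically_closed_type TYPE('a)"
    and G: "finite G" "T ` span G \<subseteq> span G" and U: "subspace U" and w: "w \<in> span G" "w \<notin> U"
  shows "\<exists>x\<in>span G. x \<notin> U \<and> (\<exists>a. T x - scale a x \<in> U)"
proof -
  define P where "P p \<longleftrightarrow> p \<noteq> 0 \<and> poly_apply scale T p w \<in> U" for p
  obtain p0 where "P p0"
    using exists_annihilating_poly[OF G w(1)] subspace_0[OF U] unfolding P_def by metis
  then obtain p where p: "P p" "\<And>q. P q \<Longrightarrow> degree p \<le> degree q"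
    using ex_has_least_nat[of P p0 degree] by blast
  have "degree p > 0"
  proof (rule ccontr)
    assume "\<not> degree p > 0"
    then obtain c where c: "p = [:c:]"
      using degree_eq_zeroE by blast
    then have c: "c \<noteq> 0" "scale c w \<in> U"
      using p(1) by (auto simp: P_def T.zero)
    have "scale (inverse c) (scale c w) \<in> U"
      by (rule subspace_scale[OF U c(2)])
    then show False
      using w(2) c(1) by simp
  qed
  then obtain a where "poly p a = 0"
    using ac unfolding algebraically_closed_type_def by blast
  then obtain q where q: "p = [:- a, 1:] * q"
    by (metis dvdE poly_eq_0_iff_dvd)
  have "q \<noteq> 0"
    using q p(1) by (auto simp: P_def)
  then have "degree p = Suc (degree q)"
    unfolding q by (subst degree_mult_eq) auto
  then have "poly_apply scale T q w \<notin> U"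
    using p(2)[of q] \<open>q \<noteq> 0\<close> by (auto simp: P_def)
  moreover have "T (poly_apply scale T q w) - scale a (poly_apply scale T q w) \<in> U"
    using p(1) by (simp only: P_def q poly_apply_linear_mult)
  moreover have "poly_apply scale T q w \<in> span G"
    using G w by (intro poly_apply_in_subspace) auto
  ultimately show ?thesis
    by blast
qed

text \<open>A largest independent set in \<open>W\<close> on which \<open>T\<close> is triangular
  must span \<open>W\<close>: otherwise an eigenvector modulo its span could be added on
  top.\<close>

lemma triangularizable_on_algebraically_closed:
  assumes ac: "algebraically_closed_type TYPE('a)"
    and W: "finite_dim_subspace scale W" "invariant_subspace scale T W"
  shows "triangularizable_on scale W T"
proof -
  obtain G where G: "finite G" "span G = W"
    using W by (auto simp: finite_dim_subspace_def basis_of_def)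
  then have inv: "T ` span G \<subseteq> span G"
    using W by (simp add: invariant_subspace_def)
  define P where "P B \<longleftrightarrow> B \<subseteq> W \<and> independent B \<and>
    (\<exists>r. well_order_on B r \<and> triangular scale B r T)" for B
  have bound: "finite B \<and> card B \<le> card G" if "P B" for B
    using that independent_span_bound[OF G(1), of B] G(2) by (auto simp: P_def)
  have "P {}"
    by (auto simp: P_def triangular_def independent_empty intro: exI[of _ "{}"])
  then obtain B where B: "P B" "\<And>B'. P B' \<Longrightarrow> card B' \<le> card B"
    using ex_has_greatest_nat[of P "{}" card "Suc (card G)"] bound by (metis le_imp_less_Suc)
  obtain r where r: "well_order_on B r" "triangular scale B r T"
    using B(1) by (auto simp: P_def)
  have "span B = W"
  proof (rule ccontr)
    assume ne: "span B \<noteq> W"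
    have "span B \<subseteq> W"
      using B(1) G(2) by (intro span_minimal) (auto simp: P_def)
    then obtain w where "w \<in> span G" "w \<notin> span B"
      using ne G(2) by blast
    then obtain x a where x: "x \<in> W" "x \<notin> span B" "T x - scale a x \<in> span B"
      using exists_eigenvector_mod_subspace[OF ac G(1) inv subspace_span] G(2) by metis
    have xB: "x \<notin> B"
      using x(2) span_base by blast
    \<comment> \<open>The singleton gets constant rank 0; \<open>T x\<close> lies in the span of
      \<open>x\<close> and \<open>B\<close>.\<close>
    have "\<exists>q. well_order_on (B \<union> {x}) q \<and> triangular scale (B \<union> {x}) q T"
    proof (rule triangular_extend[OF r])
      show "T v \<in> span (insert v (B \<union> {u \<in> {x}. (\<lambda>_. 0 :: nat) u < (\<lambda>_. 0) v}))" if "v \<in> {x}" for v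
        using that x(3) by (auto simp: span_breakdown_eq)
    qed (use xB in auto)
    then have "P (insert x B)"
      using B(1) x(1,2) xB by (auto simp: P_def independent_insert)
    then have "card (insert x B) \<le> card B"
      by (rule B(2))
    then show False
      using bound[OF B(1)] xB by simp
  qed
  then show ?thesis
    using B(1) unfolding triangularizable_on_def basis_of_def P_def by blast
qed

end

subsection \<open>Closure in the function topology\<close>

text \<open>The unions of base sets must be shown to form a topology. If \<open>S\<close> lies in
  two base sets, their intersection is the base set of maps agreeing with \<open>S\<close> on the
  sum of the two subspaces.\<close>

lemma openin_function_topology:
  "openin (function_topology scale) = arbitrary union_of (\<lambda>N. N \<in> function_topology_base scale)"
proof -
  have "(arbitrary union_of (\<lambda>N. N \<in> function_topology_base scale)) (N1 \<inter> N2)"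
    if N: "N1 \<in> function_topology_base scale" "N2 \<in> function_topology_base scale" for N1 N2
  proof (cases "N1 \<inter> N2 = {}")
    case True
    then show ?thesis
      by (simp add: arbitrary_union_of_empty)
  next
    case False
    then obtain S where S: "S \<in> N1" "S \<in> N2"
      by blast
    obtain T1 W1 where N1: "finite_dim_subspace scale W1" "N1 = {S \<in> End_space scale. \<forall>w\<in>W1. S w = T1 w}"
      using N(1) unfolding function_topology_base_def by blast
    obtain T2 W2 where N2: "finite_dim_subspace scale W2" "N2 = {S \<in> End_space scale. \<forall>w\<in>W2. S w = T2 w}"
      using N(2) unfolding function_topology_base_def by blast
    obtain G1 G2 where G: "finite G1" "span G1 = W1" "finite G2" "span G2 = W2"
      using N1(1) N2(1) by (auto simp: finite_dim_subspace_def basis_of_def)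
    have agree: "(\<forall>w\<in>span (G1 \<union> G2). R w = S w) \<longleftrightarrow> (\<forall>w\<in>W1. R w = S w) \<and> (\<forall>w\<in>W2. R w = S w)"
      if R: "R \<in> End_space scale" for R
    proof -
      interpret vector_space_pair scale scale ..
      have lin: "Vector_Spaces.linear scale scale R" "Vector_Spaces.linear scale scale S"
        using R S(1) N1(2) by (auto simp: End_space_def)
      have "W1 \<subseteq> span (G1 \<union> G2)" "W2 \<subseteq> span (G1 \<union> G2)" "G1 \<subseteq> W1" "G2 \<subseteq> W2"
        using G span_mono[of G1 "G1 \<union> G2"] span_mono[of G2 "G1 \<union> G2"] span_superset by auto
      then show ?thesis
        using linear_eq_on[OF lin, of _ "G1 \<union> G2"] by blast
    qed
    have "N1 \<inter> N2 = {R \<in> End_space scale. \<forall>w\<in>span (G1 \<union> G2). R w = S w}"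
    proof (rule set_eqI)
      fix R
      show "R \<in> N1 \<inter> N2 \<longleftrightarrow> R \<in> {R \<in> End_space scale. \<forall>w\<in>span (G1 \<union> G2). R w = S w}"
        using S N1(2) N2(2) agree[of R] by auto
    qed
    moreover have "S \<in> End_space scale"
      using S(1) N1(2) by blast
    moreover have "finite_dim_subspace scale (span (G1 \<union> G2))"
      using G by (intro finite_dim_subspace_span) simp
    ultimately have "N1 \<inter> N2 \<in> function_topology_base scale"
      unfolding function_topology_base_def by blast
    then show ?thesis
      by (simp add: union_of_inc arbitrary_def)
  qed
  then show ?thesis
    unfolding function_topology_def by (simp add: istopology_base_eq topology_inverse')
qed

lemma topspace_function_topology: "topspace (function_topology scale) = End_space scale"
  by (simp add: function_topology_eq_product)

text \<open>The sets of maps agreeing with \<open>T\<close> on a finite-dimensional \<open>W\<close>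
  form a neighbourhood base at \<open>T\<close>: a base set centred at \<open>R\<close> and
  containing \<open>T\<close> may be recentred at \<open>T\<close>.\<close>

lemma in_closure_of_function_topology:
  assumes "X \<subseteq> End_space scale" "T \<in> End_space scale"
  shows "T \<in> function_topology scale closure_of X \<longleftrightarrow>
    (\<forall>W. finite_dim_subspace scale W \<longrightarrow> (\<exists>S\<in>X. \<forall>w\<in>W. S w = T w))"
    (is "_ \<longleftrightarrow> ?approx")
proof -
  have base: "openin (function_topology scale) {S \<in> End_space scale. \<forall>w\<in>W. S w = T w}"
    if "finite_dim_subspace scale W" for W
    unfolding openin_function_topology
    using that assms(2) by (intro union_of_inc) (auto simp: arbitrary_def function_topology_base_def)
  show ?thesis
  proof
    assume cl: "T \<in> function_topology scale closure_of X"
    show ?approx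
    proof (intro allI impI)
      fix W
      assume "finite_dim_subspace scale W"
      from base[OF this] have "\<exists>S. S \<in> X \<and> S \<in> {S \<in> End_space scale. \<forall>w\<in>W. S w = T w}"
        using cl assms(2) by (auto simp: in_closure_of dest!: spec[of _ "{S \<in> End_space scale. \<forall>w\<in>W. S w = T w}"])
      then show "\<exists>S\<in>X. \<forall>w\<in>W. S w = T w"
        by blast
    qed
  next
    assume approx: ?approx
    show "T \<in> function_topology scale closure_of X"
      unfolding in_closure_of topspace_function_topology
    proof (intro conjI allI impI)
      fix O'
      assume O': "T \<in> O' \<and> openin (function_topology scale) O'"
      then obtain N where N: "N \<in> function_topology_base scale" "T \<in> N" "N \<subseteq> O'"
        unfolding openin_function_topology union_of_def by auto
      then obtain R W where W: "finite_dim_subspace scale W" "N = {S \<in> End_space scale. \<forall>w\<in>W. S w = R w}"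
        unfolding function_topology_base_def by blast
      obtain S where "S \<in> X" "\<forall>w\<in>W. S w = T w"
        using approx W(1) by blast
      then have "S \<in> N"
        using N(2) W(2) assms(1) by auto
      then show "\<exists>y. y \<in> X \<and> y \<in> O'"
        using \<open>S \<in> X\<close> N(3) by blast
    qed (rule assms(2))
  qed
qed

lemma triangularizable_on_cong:
  assumes "\<And>w. w \<in> W \<Longrightarrow> S w = T w"
  shows "triangularizable_on scale W S \<longleftrightarrow> triangularizable_on scale W T"
proof -
  have "triangular scale B r S \<longleftrightarrow> triangular scale B r T" if "basis_of scale B W" for B r
    using that assms span_base by (auto simp: basis_of_def triangular_def)
  then show ?thesis
    unfolding triangularizable_on_def by blast
qed

text \<open>If a triangularizable \<open>S\<close> agrees with \<open>T\<close> on an invariant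
  \<open>W\<close>, then \<open>W\<close> is invariant under \<open>S\<close> as well, and
  triangularizability on \<open>W\<close> passes from \<open>S\<close> to \<open>T\<close>. The
  converse approximates \<open>T\<close> by \<open>triangularizable_extension\<close>.\<close>

lemma in_closure_of_triangularizables:
  assumes T: "T \<in> End_space scale"
  shows "T \<in> function_topology scale closure_of triangularizables scale \<longleftrightarrow>
    (\<forall>W. finite_dim_subspace scale W \<and> invariant_subspace scale T W \<longrightarrow> triangularizable_on scale W T)"
    (is "?cl \<longleftrightarrow> ?res")
proof -
  have sub: "triangularizables scale \<subseteq> End_space scale"
    by (auto simp: triangularizables_def)
  show ?thesis
    unfolding in_closure_of_function_topology[OF sub T]
  proof (intro iffI allI impI)
    fix W
    assume approx: "\<forall>W. finite_dim_subspace scale W \<longrightarrow> (\<exists>S\<in>triangularizables scale. \<forall>w\<in>W. S w = T w)"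
      and W: "finite_dim_subspace scale W \<and> invariant_subspace scale T W"
    obtain S where S: "S \<in> triangularizables scale" "\<And>w. w \<in> W \<Longrightarrow> S w = T w"
      using approx W by blast
    have "invariant_subspace scale S W"
      using W S(2) by (auto simp: invariant_subspace_def)
    then have "triangularizable_on scale W S"
      using S(1) by (intro triangularizable_on_subspace[of S UNIV W]) (auto simp: triangularizables_def End_space_def)
    then show "triangularizable_on scale W T"
      using triangularizable_on_cong S(2) by blast
  next
    fix W
    assume "?res" "finite_dim_subspace scale W"
    then show "\<exists>S\<in>triangularizables scale. \<forall>w\<in>W. S w = T w"
      using T by (intro triangularizable_extension) (auto simp: End_space_def)
  qed
qed

end

theorem theorem19:
  fixes scale :: "'k::field \<Rightarrow> 'v::ab_group_add \<Rightarrow> 'v"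
  assumes "vector_space scale"
  shows "(\<forall>T \<in> End_space scale.
            T \<in> function_topology scale closure_of triangularizables scale \<longleftrightarrow>
            (\<forall>W. finite_dim_subspace scale W \<and> invariant_subspace scale T W
               \<longrightarrow> triangularizable_on scale W T)) \<and>
         (algebraically_closed_type TYPE('k) \<longrightarrow>
            function_topology scale closure_of triangularizables scale
              = End_space scale)"
proof -
  interpret vector_space scale
    by (rule assms)
  \<comment> \<open>Over an algebraically closed field the restriction criterion holds for every
    endomorphism.\<close>
  have "End_space scale \<subseteq> function_topology scale closure_of triangularizables scale"
    if "algebraically_closed_type TYPE('k)"
    using in_closure_of_triangularizables triangularizable_on_algebraically_closed[OF _ that]
    by (auto simp: End_space_def)
  then show ?thesis
    using in_closure_of_triangularizables closure_of_subset_topspace[of "function_topology scale"]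
    unfolding topspace_function_topology by blast
qed

end
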